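(* Let $\Sigma$ be a finite non-empty alphabet. On the quotient set $\widetilde{\Sigma}^*:=\mathcal{E}_M(\Sigma^* )/\sim$, the operation $[(u_\varepsilon)]\cdot[(v_\varepsilon)]:=[(u_\varepsilon v_\varepsilon)]$ is well defined (independent of the chosen representatives) and makes $\widetilde{\Sigma}^*$ a monoid with identity element $\mathbf{1}=[(\lambda)_\varepsilon]$, the class of the constant empty net.
   Context: $\Sigma^*$ is the free monoid of finite words over $\Sigma$ under concatenation, $\lambda$ is the empty word, $|w|$ is the length of $w$. For $u\neq v$ in $\Sigma^*$, $\operatorname{lcp}(u,v)$ and $\operatorname{lcs}(u,v)$ are the lengths of the longest common prefix and of the longest common suffix of $u,v$; by convention $\operatorname{lcp}(u,u)=\operatorname{lcs}(u,u)=+\infty$. A net of words is a family $(w_\varepsilon)_{\varepsilon\in(0,1]}$ of words in $\Sigma^*$. It is moderate if there exist $N\in\mathbb{N}$, $C>0$, $\varepsilon_0>0$ with $|w_\varepsilon|\le C\varepsilon^{-N}$ for all $\varepsilon<\varepsilon_0$. $\mathcal{E}_M(\Sigma^* )$ is the set of moderate nets; it is a monoid under coordinatewise concatenation. Two moderate nets are asymptotically equivalent, $(u_\varepsilon)\sim(v_\varepsilon)$, if for every $m\in\mathbb{N}$ there exists $\varepsilon_0>0$ such that $\min\{\operatorname{lcp}(u_\varepsilon,v_\varepsilon),\operatorname{lcs}(u_\varepsilon,v_\varepsilon)\}\ge m\log_2(1/\varepsilon)$ for all $\varepsilon<\varepsilon_0$; this is an equivalence relation, and $[(w_\varepsilon)]$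 denotes the class of $(w_\varepsilon)$. *)

theory Defs
  imports
    Complex_Main
    "HOL-Library.Sublist"
    "HOL-Library.Extended_Real"
    "HOL-Algebra.Group"
begin

definition lcp :: "'a list \<Rightarrow> 'a list \<Rightarrow> enat" where
  "lcp u v = (if u = v then \<infinity> else enat (length (Longest_common_prefix {u, v})))"

definition lcs :: "'a list \<Rightarrow> 'a list \<Rightarrow> enat" where
  "lcs u v = (if u = v then \<infinity>
     else enat (length (ARG_MAX length s. suffix s u \<and> suffix s v)))"

(* A net indexed by (0,1] is a function that is undefined outside (0,1], so that equality of
   nets is equality on the index set. *)
definition nets :: "'a set \<Rightarrow> (real \<Rightarrow> 'a list) set" where
  "nets \<Sigma> = {0<..1} \<rightarrow>\<^sub>E lists \<Sigma>"

definition moderate_nets :: "'a set \<Rightarrow> (real \<Rightarrow> 'a list) set" where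
  "moderate_nets \<Sigma> = {w \<in> nets \<Sigma>. \<exists>N::nat. \<exists>C>0. \<exists>\<epsilon>\<^sub>0>0. \<forall>\<epsilon>\<in>{0<..1}.
     \<epsilon> < \<epsilon>\<^sub>0 \<longrightarrow> real (length (w \<epsilon>)) \<le> C * \<epsilon> powi (- int N)}"

definition net_append :: "(real \<Rightarrow> 'a list) \<Rightarrow> (real \<Rightarrow> 'a list) \<Rightarrow> (real \<Rightarrow> 'a list)" where
  "net_append u v = (\<lambda>\<epsilon>\<in>{0<..1}. u \<epsilon> @ v \<epsilon>)"

definition empty_net :: "real \<Rightarrow> 'a list" where
  "empty_net = (\<lambda>\<epsilon>\<in>{0<..1}. [])"

definition asymp_equiv_nets :: "'a set \<Rightarrow> ((real \<Rightarrow> 'a list) \<times> (real \<Rightarrow> 'a list)) set" where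
  "asymp_equiv_nets \<Sigma> = {(u, v). u \<in> moderate_nets \<Sigma> \<and> v \<in> moderate_nets \<Sigma> \<and>
     (\<forall>m::nat. \<exists>\<epsilon>\<^sub>0>0. \<forall>\<epsilon>\<in>{0<..1}. \<epsilon> < \<epsilon>\<^sub>0 \<longrightarrow>
        ereal (real m * log 2 (1 / \<epsilon>))
          \<le> ereal_of_enat (min (lcp (u \<epsilon>) (v \<epsilon>)) (lcs (u \<epsilon>) (v \<epsilon>))))}"

definition net_class :: "'a set \<Rightarrow> (real \<Rightarrow> 'a list) \<Rightarrow> (real \<Rightarrow> 'a list) set" where
  "net_class \<Sigma> w = asymp_equiv_nets \<Sigma> `` {w}"

(* The product of two classes is the union of [uv] over all representatives u, v.  It is a single
   class exactly because [uv] does not depend on the representatives. *)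
definition generalized_words :: "'a set \<Rightarrow> (real \<Rightarrow> 'a list) set monoid" where
  "generalized_words \<Sigma> =
     \<lparr> carrier = moderate_nets \<Sigma> // asymp_equiv_nets \<Sigma>,
       mult = (\<lambda>X Y. \<Union>u\<in>X. \<Union>v\<in>Y. net_class \<Sigma> (net_append u v)),
       one = net_class \<Sigma> empty_net \<rparr>"

lemma le_lcp_iff:
  "enat n \<le> lcp u v \<longleftrightarrow> u = v \<or> (n \<le> length u \<and> n \<le> length v \<and> take n u = take n v)"
proof (cases "u = v")
  case False
  let ?p = "Longest_common_prefix {u, v}"
  have p: "prefix ?p u" "prefix ?p v"
    by (simp_all add: Longest_common_prefix_prefix)
  have "n \<le> length ?p \<longleftrightarrow> n \<le> length u \<and> n \<le> length v \<and> take n u = take n v"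
  proof
    assume n: "n \<le> length ?p"
    have "take n x = take n y" if "prefix y x" "n \<le> length y" for x y :: "'a list"
      using that by (auto simp: prefix_def)
    from this[OF p(1) n] this[OF p(2) n] have "take n u = take n ?p" "take n v = take n ?p" .
    moreover have "length ?p \<le> length u" "length ?p \<le> length v"
      using p by (auto dest: prefix_length_le)
    ultimately show "n \<le> length u \<and> n \<le> length v \<and> take n u = take n v"
      using n by simp
  next
    assume n: "n \<le> length u \<and> n \<le> length v \<and> take n u = take n v"
    have "length (take n u) \<le> length ?p"
    proof (rule Longest_common_prefix_longest)
      show "\<forall>xs\<in>{u, v}. prefix (take n u) xs"
        using n take_is_prefix[of n u] take_is_prefix[of n v] by simp
    qed simp
    then show "n \<le> length ?p" using n by simp
  qed
  then show ?thesis using False by (simp add: lcp_def)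
qed (simp add: lcp_def)

lemma lcs_eq_lcp_rev: "lcs u v = lcp (rev u) (rev v)"
proof (cases "u = v")
  case False
  let ?P = "\<lambda>s. suffix s u \<and> suffix s v"
  have ex: "?P []" by simp
  have bd: "\<forall>y. ?P y \<longrightarrow> length y < Suc (length u)"
    by (auto dest: suffix_length_le)
  have s: "?P (arg_max length ?P)" "\<And>s. ?P s \<Longrightarrow> length s \<le> length (arg_max length ?P)"
    using arg_max_nat_lemma[of ?P, OF ex bd] by auto
  let ?p = "Longest_common_prefix {rev u, rev v}"
  have p: "prefix ?p (rev u)" "prefix ?p (rev v)"
    by (simp_all add: Longest_common_prefix_prefix)
  have "length (rev ?p) \<le> length (arg_max length ?P)"
    by (rule s(2)) (use p in \<open>simp add: suffix_to_prefix\<close>)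
  moreover have "length (rev (arg_max length ?P)) \<le> length ?p"
    by (rule Longest_common_prefix_longest) (use s(1) in \<open>auto simp: suffix_to_prefix\<close>)
  ultimately show ?thesis using False by (simp add: lcs_def lcp_def)
qed (simp add: lcs_def lcp_def)

lemma lcp_commute: "lcp u v = lcp v u"
  by (simp add: lcp_def insert_commute)

lemma lcp_ultrametric: "min (lcp u v) (lcp v w) \<le> lcp u w"
proof (cases "u = v \<or> v = w")
  case False
  then obtain a b where "lcp u v = enat a" "lcp v w = enat b"
    by (auto simp: lcp_def)
  moreover define n where "n = min a b"
  ultimately have n: "min (lcp u v) (lcp v w) = enat n" by simp
  have "enat n \<le> lcp u v" "enat n \<le> lcp v w"
    by (simp_all flip: n)
  with False have "enat n \<le> lcp u w"
    by (auto simp: le_lcp_iff)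
  then show ?thesis by (simp add: n)
qed auto

lemma equiv_asymp_equiv_nets: "equiv (moderate_nets \<Sigma>) (asymp_equiv_nets \<Sigma>)"
proof (rule equivI)
  let ?d = "\<lambda>u v :: 'a list. min (lcp u v) (lcs u v)"
  have ultra: "min (?d u v) (?d v w) \<le> ?d u w" for u v w
    using lcp_ultrametric[of u v w] lcp_ultrametric[of "rev u" "rev v" "rev w"]
    unfolding lcs_eq_lcp_rev by (auto simp: min_le_iff_disj)
  show "asymp_equiv_nets \<Sigma> \<subseteq> moderate_nets \<Sigma> \<times> moderate_nets \<Sigma>"
    by (auto simp: asymp_equiv_nets_def)
  show "refl_on (moderate_nets \<Sigma>) (asymp_equiv_nets \<Sigma>)"
    by (auto simp: refl_on_def asymp_equiv_nets_def lcp_def lcs_def intro: exI[of _ 1])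
  have "?d u v = ?d v u" for u v
    by (simp add: lcs_eq_lcp_rev lcp_commute)
  then show "sym (asymp_equiv_nets \<Sigma>)"
    by (auto simp: sym_def asymp_equiv_nets_def)
  show "trans (asymp_equiv_nets \<Sigma>)"
  proof (rule transI)
    fix u v w assume uv: "(u, v) \<in> asymp_equiv_nets \<Sigma>" and vw: "(v, w) \<in> asymp_equiv_nets \<Sigma>"
    have "\<exists>\<epsilon>\<^sub>0>0. \<forall>\<epsilon>\<in>{0<..1}. \<epsilon> < \<epsilon>\<^sub>0 \<longrightarrow>
        ereal (real m * log 2 (1 / \<epsilon>)) \<le> ereal_of_enat (?d (u \<epsilon>) (w \<epsilon>))" for m :: nat
    proof -
      obtain e1 where e1: "e1 > 0" "\<And>\<epsilon>. \<epsilon> \<in> {0<..1} \<Longrightarrow> \<epsilon> < e1 \<Longrightarrow>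
          ereal (real m * log 2 (1 / \<epsilon>)) \<le> ereal_of_enat (?d (u \<epsilon>) (v \<epsilon>))"
        using uv unfolding asymp_equiv_nets_def by blast
      obtain e2 where e2: "e2 > 0" "\<And>\<epsilon>. \<epsilon> \<in> {0<..1} \<Longrightarrow> \<epsilon> < e2 \<Longrightarrow>
          ereal (real m * log 2 (1 / \<epsilon>)) \<le> ereal_of_enat (?d (v \<epsilon>) (w \<epsilon>))"
        using vw unfolding asymp_equiv_nets_def by blast
      have "ereal (real m * log 2 (1 / \<epsilon>)) \<le> ereal_of_enat (?d (u \<epsilon>) (w \<epsilon>))"
        if "\<epsilon> \<in> {0<..1}" "\<epsilon> < min e1 e2" for \<epsilon>
      proof -
        have "ereal (real m * log 2 (1 / \<epsilon>))
            \<le> ereal_of_enat (min (?d (u \<epsilon>) (v \<epsilon>)) (?d (v \<epsilon>) (w \<epsilon>)))"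
          using e1(2)[of \<epsilon>] e2(2)[of \<epsilon>] that by (simp only: min_def split: if_splits) auto
        also have "\<dots> \<le> ereal_of_enat (?d (u \<epsilon>) (w \<epsilon>))"
          unfolding ereal_of_enat_le_iff by (rule ultra)
        finally show ?thesis .
      qed
      then show ?thesis using e1(1) e2(1) by (intro exI[of _ "min e1 e2"]) auto
    qed
    then show "(u, w) \<in> asymp_equiv_nets \<Sigma>"
      using uv vw unfolding asymp_equiv_nets_def by blast
  qed
qed

end

theory Submission
  imports Defs
begin

text \<open>
  The asymptotic equivalence is controlled by the two-sided agreement
  \<open>d u v = min (lcp u v) (lcs u v)\<close> of two words (called \<open>agreement\<close> below), and everything rests on the inequality
  \<open>d (u @ v) (u' @ v') \<ge> min (d u u') (d v v')\<close> (lemma \<open>agreement_append\<close>), in which no constant is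
  lost: if \<open>u \<noteq> u'\<close>, then the common prefix of \<open>u\<close> and \<open>u'\<close> is already a common
  prefix of the products, while if \<open>u = u'\<close>, the common prefix of \<open>v\<close> and \<open>v'\<close> only gets
  longer when \<open>u\<close> is put in front of it; reversal exchanges prefixes and suffixes.
  Consequently any lower bound \<open>m log\<^sub>2 (1/\<epsilon>)\<close> that both factors satisfy for small
  \<open>\<epsilon>\<close> is inherited by the product, so that \<open>\<sim>\<close> is a congruence for concatenation of moderate
  nets (lemma \<open>congruent2_net_append\<close>).

  The moderate nets themselves form a monoid under concatenation, because a sum of two functions of
  polynomial growth in \<open>1/\<epsilon>\<close> has polynomial growth and the monoid laws hold at each \<open>\<epsilon>\<close>. The
  quotient of a monoid by a congruence is a monoid.
\<close>

section \<open>Agreement of concatenated words\<close>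

lemma lcp_append: "min (lcp u u') (lcp v v') \<le> lcp (u @ v) (u' @ v')"
proof (cases "u = u' \<and> v = v'")
  case False
  then have "min (lcp u u') (lcp v v') \<noteq> \<infinity>"
    by (auto simp: lcp_def min_def)
  then obtain n where n: "min (lcp u u') (lcp v v') = enat n"
    by auto
  then have "enat n \<le> lcp u u'" "enat n \<le> lcp v v'"
    by (simp_all flip: n)
  then have "enat n \<le> lcp (u @ v) (u' @ v')"
  proof (cases "u = u'")
    case True
    \<comment> \<open>The tails agree on their first \<open>n\<close> letters, hence also on the first \<open>n - length u\<close> that are
       needed here.\<close>
    have "take (n - length u) v = take (n - length u) v'" if "take n v = take n v'"
      using arg_cong[OF that, of "take (n - length u)"] by simp
    then show ?thesis
      using True \<open>enat n \<le> lcp v v'\<close> by (auto simp: le_lcp_iff)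
  qed (auto simp: le_lcp_iff)
  then show ?thesis by (simp add: n)
qed (simp add: lcp_def)

definition agreement :: "'a list \<Rightarrow> 'a list \<Rightarrow> enat" where
  "agreement u v = min (lcp u v) (lcs u v)"

lemma agreement_append: "min (agreement u u') (agreement v v') \<le> agreement (u @ v) (u' @ v')"
  using lcp_append[of u u' v v'] lcp_append[of "rev v" "rev v'" "rev u" "rev u'"]
  by (auto simp: agreement_def lcs_eq_lcp_rev min_le_iff_disj)

section \<open>The monoid of moderate nets\<close>

lemma moderate_netsI:
  assumes "w \<in> nets \<Sigma>" "C > 0" "\<epsilon>\<^sub>0 > 0"
    and "\<And>\<epsilon>. \<epsilon> \<in> {0<..1} \<Longrightarrow> \<epsilon> < \<epsilon>\<^sub>0 \<Longrightarrow> real (length (w \<epsilon>)) \<le> C * \<epsilon> powi (- int N)"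
  shows "w \<in> moderate_nets \<Sigma>"
  using assms unfolding moderate_nets_def by blast

lemma moderate_netsE:
  assumes "w \<in> moderate_nets \<Sigma>"
  obtains N C \<epsilon>\<^sub>0 where "C > 0" "\<epsilon>\<^sub>0 > 0"
    "\<And>\<epsilon>. \<epsilon> \<in> {0<..1} \<Longrightarrow> \<epsilon> < \<epsilon>\<^sub>0 \<Longrightarrow> real (length (w \<epsilon>)) \<le> C * \<epsilon> powi (- int N)"
  using assms unfolding moderate_nets_def by blast

lemma moderate_nets_imp_nets: "w \<in> moderate_nets \<Sigma> \<Longrightarrow> w \<in> nets \<Sigma>"
  by (simp add: moderate_nets_def)

lemma net_append_in_nets: "u \<in> nets \<Sigma> \<Longrightarrow> v \<in> nets \<Sigma> \<Longrightarrow> net_append u v \<in> nets \<Sigma>"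
  by (force simp: nets_def net_append_def PiE_iff)

lemma empty_net_moderate: "empty_net \<in> moderate_nets \<Sigma>"
  by (rule moderate_netsI[of _ _ 1 1 0]) (auto simp: empty_net_def nets_def)

text \<open>Since \<open>\<epsilon> \<le> 1\<close>, both growth bounds may be raised to the exponent \<open>N + M\<close>, where they add
  up.\<close>
lemma net_append_moderate:
  assumes u: "u \<in> moderate_nets \<Sigma>" and v: "v \<in> moderate_nets \<Sigma>"
  shows "net_append u v \<in> moderate_nets \<Sigma>"
proof -
  obtain N C e where e: "C > 0" "e > 0"
    "\<And>\<epsilon>. \<epsilon> \<in> {0<..1} \<Longrightarrow> \<epsilon> < e \<Longrightarrow> real (length (u \<epsilon>)) \<le> C * \<epsilon> powi (- int N)"
    by (rule moderate_netsE[OF u]) (rule that)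
  obtain M D e' where e': "D > 0" "e' > 0"
    "\<And>\<epsilon>. \<epsilon> \<in> {0<..1} \<Longrightarrow> \<epsilon> < e' \<Longrightarrow> real (length (v \<epsilon>)) \<le> D * \<epsilon> powi (- int M)"
    by (rule moderate_netsE[OF v]) (rule that)
  show ?thesis
  proof (rule moderate_netsI[of _ _ "C + D" "min e e'" "N + M"])
    show "net_append u v \<in> nets \<Sigma>"
      using u v by (intro net_append_in_nets moderate_nets_imp_nets)
    fix \<epsilon> :: real assume \<epsilon>: "\<epsilon> \<in> {0<..1}" "\<epsilon> < min e e'"
    have mono: "\<epsilon> powi (- int K) \<le> \<epsilon> powi (- int (N + M))" if "K \<le> N + M" for K
      using \<epsilon> that power_decreasing[of K "N + M" \<epsilon>]
      by (simp add: power_int_minus le_imp_inverse_le del: of_nat_add)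
    have "real (length (net_append u v \<epsilon>)) = real (length (u \<epsilon>)) + real (length (v \<epsilon>))"
      using \<epsilon> by (simp add: net_append_def)
    also have "\<dots> \<le> C * \<epsilon> powi (- int N) + D * \<epsilon> powi (- int M)"
      using \<epsilon> e(3) e'(3) by (intro add_mono) auto
    also have "\<dots> \<le> C * \<epsilon> powi (- int (N + M)) + D * \<epsilon> powi (- int (N + M))"
      using e(1) e'(1) by (intro add_mono mult_left_mono mono) auto
    finally show "real (length (net_append u v \<epsilon>)) \<le> (C + D) * \<epsilon> powi (- int (N + M))"
      by (simp add: distrib_right)
  qed (use e e' in auto)
qed

lemma net_append_assoc: "net_append (net_append u v) w = net_append u (net_append v w)"
  by (auto simp: net_append_def)

text \<open>The unit laws are equalities of nets, not merely equivalences, because nets take the default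
  value outside \<open>(0,1]\<close>, just as concatenations do.\<close>
lemma net_append_empty_left: "u \<in> nets \<Sigma> \<Longrightarrow> net_append empty_net u = u"
  by (force simp: net_append_def empty_net_def nets_def PiE_iff extensional_def)

lemma net_append_empty_right: "u \<in> nets \<Sigma> \<Longrightarrow> net_append u empty_net = u"
  by (force simp: net_append_def empty_net_def nets_def PiE_iff extensional_def)

section \<open>Concatenation on the quotient\<close>

lemma asymp_equiv_netsI:
  assumes "u \<in> moderate_nets \<Sigma>" "v \<in> moderate_nets \<Sigma>"
    and "\<And>m::nat. \<exists>\<epsilon>\<^sub>0>0. \<forall>\<epsilon>\<in>{0<..1}. \<epsilon> < \<epsilon>\<^sub>0 \<longrightarrow>
      ereal (real m * log 2 (1 / \<epsilon>)) \<le> ereal_of_enat (agreement (u \<epsilon>) (v \<epsilon>))"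
  shows "(u, v) \<in> asymp_equiv_nets \<Sigma>"
  using assms unfolding asymp_equiv_nets_def agreement_def by blast

lemma asymp_equiv_nets_bound:
  assumes "(u, v) \<in> asymp_equiv_nets \<Sigma>"
  obtains \<epsilon>\<^sub>0 where "\<epsilon>\<^sub>0 > 0"
    "\<And>\<epsilon>. \<epsilon> \<in> {0<..1} \<Longrightarrow> \<epsilon> < \<epsilon>\<^sub>0 \<Longrightarrow>
      ereal (real m * log 2 (1 / \<epsilon>)) \<le> ereal_of_enat (agreement (u \<epsilon>) (v \<epsilon>))"
  using assms unfolding asymp_equiv_nets_def agreement_def by blast

lemma asymp_equiv_nets_moderate:
  "(u, v) \<in> asymp_equiv_nets \<Sigma> \<Longrightarrow> u \<in> moderate_nets \<Sigma> \<and> v \<in> moderate_nets \<Sigma>"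
  by (simp add: asymp_equiv_nets_def)

lemma asymp_equiv_nets_append:
  assumes u: "(u, u') \<in> asymp_equiv_nets \<Sigma>" and v: "(v, v') \<in> asymp_equiv_nets \<Sigma>"
  shows "(net_append u v, net_append u' v') \<in> asymp_equiv_nets \<Sigma>"
proof (rule asymp_equiv_netsI)
  show "net_append u v \<in> moderate_nets \<Sigma>" "net_append u' v' \<in> moderate_nets \<Sigma>"
    using u v by (auto intro: net_append_moderate dest: asymp_equiv_nets_moderate)
  fix m :: nat
  obtain e where e: "e > 0" "\<And>\<epsilon>. \<epsilon> \<in> {0<..1} \<Longrightarrow> \<epsilon> < e \<Longrightarrow>
      ereal (real m * log 2 (1 / \<epsilon>)) \<le> ereal_of_enat (agreement (u \<epsilon>) (u' \<epsilon>))"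
    by (rule asymp_equiv_nets_bound[OF u, where m = m]) (rule that)
  obtain e' where e': "e' > 0" "\<And>\<epsilon>. \<epsilon> \<in> {0<..1} \<Longrightarrow> \<epsilon> < e' \<Longrightarrow>
      ereal (real m * log 2 (1 / \<epsilon>)) \<le> ereal_of_enat (agreement (v \<epsilon>) (v' \<epsilon>))"
    by (rule asymp_equiv_nets_bound[OF v, where m = m]) (rule that)
  have "ereal (real m * log 2 (1 / \<epsilon>))
      \<le> ereal_of_enat (agreement (net_append u v \<epsilon>) (net_append u' v' \<epsilon>))"
    if \<epsilon>: "\<epsilon> \<in> {0<..1}" "\<epsilon> < min e e'" for \<epsilon>
  proof -
    have "ereal (real m * log 2 (1 / \<epsilon>))
        \<le> ereal_of_enat (min (agreement (u \<epsilon>) (u' \<epsilon>)) (agreement (v \<epsilon>) (v' \<epsilon>)))"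
      using e(2)[of \<epsilon>] e'(2)[of \<epsilon>] \<epsilon> by (simp only: min_def split: if_splits) auto
    also have "\<dots> \<le> ereal_of_enat (agreement (u \<epsilon> @ v \<epsilon>) (u' \<epsilon> @ v' \<epsilon>))"
      unfolding ereal_of_enat_le_iff by (rule agreement_append)
    finally show ?thesis
      using \<epsilon> by (simp add: net_append_def)
  qed
  then show "\<exists>\<epsilon>\<^sub>0>0. \<forall>\<epsilon>\<in>{0<..1}. \<epsilon> < \<epsilon>\<^sub>0 \<longrightarrow> ereal (real m * log 2 (1 / \<epsilon>))
      \<le> ereal_of_enat (agreement (net_append u v \<epsilon>) (net_append u' v' \<epsilon>))"
    using e(1) e'(1) by (intro exI[of _ "min e e'"]) auto
qed

lemma net_class_eq_iff:
  assumes "u \<in> moderate_nets \<Sigma>" "v \<in> moderate_nets \<Sigma>"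
  shows "net_class \<Sigma> u = net_class \<Sigma> v \<longleftrightarrow> (u, v) \<in> asymp_equiv_nets \<Sigma>"
  unfolding net_class_def by (rule eq_equiv_class_iff[OF equiv_asymp_equiv_nets assms])

text \<open>This turns the union over all representatives that defines the product of two classes into
  the class of a single concatenation (lemma \<open>mult_net_class\<close>).\<close>
lemma congruent2_net_append:
  "congruent2 (asymp_equiv_nets \<Sigma>) (asymp_equiv_nets \<Sigma>)
     (\<lambda>u v. net_class \<Sigma> (net_append u v))"
proof (rule congruent2I')
  fix u u' v v' assume "(u, u') \<in> asymp_equiv_nets \<Sigma>" "(v, v') \<in> asymp_equiv_nets \<Sigma>"
  from asymp_equiv_nets_append[OF this]
  show "net_class \<Sigma> (net_append u v) = net_class \<Sigma> (net_append u' v')"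
    using asymp_equiv_nets_moderate net_class_eq_iff by blast
qed

lemma mult_net_class:
  assumes "u \<in> moderate_nets \<Sigma>" "v \<in> moderate_nets \<Sigma>"
  shows "net_class \<Sigma> u \<otimes>\<^bsub>generalized_words \<Sigma>\<^esub> net_class \<Sigma> v = net_class \<Sigma> (net_append u v)"
  using UN_equiv_class2[OF equiv_asymp_equiv_nets equiv_asymp_equiv_nets congruent2_net_append assms]
  by (simp add: generalized_words_def net_class_def)

lemma carrier_generalized_words:
  "carrier (generalized_words \<Sigma>) = net_class \<Sigma> ` moderate_nets \<Sigma>"
  by (auto simp: generalized_words_def quotient_def net_class_def)

lemma one_generalized_words: "\<one>\<^bsub>generalized_words \<Sigma>\<^esub> = net_class \<Sigma> empty_net"
  by (simp add: generalized_words_def)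

lemma monoid_generalized_words: "monoid (generalized_words \<Sigma>)"
  by (rule monoidI) (auto simp: carrier_generalized_words one_generalized_words mult_net_class
    net_append_moderate empty_net_moderate net_append_assoc
    net_append_empty_left[OF moderate_nets_imp_nets]
    net_append_empty_right[OF moderate_nets_imp_nets])

theorem theorem2p1:
  fixes \<Sigma> :: "'a set"
  assumes "finite \<Sigma>" and "\<Sigma> \<noteq> {}"
  shows "(\<forall>u\<in>moderate_nets \<Sigma>. \<forall>u'\<in>moderate_nets \<Sigma>. \<forall>v\<in>moderate_nets \<Sigma>. \<forall>v'\<in>moderate_nets \<Sigma>.
            net_class \<Sigma> u = net_class \<Sigma> u' \<and> net_class \<Sigma> v = net_class \<Sigma> v' \<longrightarrow>
            net_class \<Sigma> (net_append u v) = net_class \<Sigma> (net_append u' v'))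
       \<and> (\<forall>u\<in>moderate_nets \<Sigma>. \<forall>v\<in>moderate_nets \<Sigma>.
            net_class \<Sigma> u \<otimes>\<^bsub>generalized_words \<Sigma>\<^esub> net_class \<Sigma> v = net_class \<Sigma> (net_append u v))
       \<and> monoid (generalized_words \<Sigma>)
       \<and> \<one>\<^bsub>generalized_words \<Sigma>\<^esub> = net_class \<Sigma> empty_net"
proof (intro conjI ballI impI)
  fix u u' v v'
  assume mod: "u \<in> moderate_nets \<Sigma>" "u' \<in> moderate_nets \<Sigma>" "v \<in> moderate_nets \<Sigma>"
      "v' \<in> moderate_nets \<Sigma>"
    and "net_class \<Sigma> u = net_class \<Sigma> u' \<and> net_class \<Sigma> v = net_class \<Sigma> v'"
  then have "(u, u') \<in> asymp_equiv_nets \<Sigma>" "(v, v') \<in> asymp_equiv_nets \<Sigma>"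
    by (simp_all add: net_class_eq_iff)
  then show "net_class \<Sigma> (net_append u v) = net_class \<Sigma> (net_append u' v')"
    by (rule congruent2D[OF congruent2_net_append])
qed (auto simp: mult_net_class monoid_generalized_words one_generalized_words)

end
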